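(* Let $\mathscr{H}$ be a reproducing kernel Hilbert space on a non-empty set $\mathscr{X}$, let $S,T\in\mathscr{B}(\mathscr{H})$ and let $\theta\in(0,\frac{\pi}{2})$ be such that $T^*S\in\Pi^{\mathbf{Ber}}_{\theta}$. Then for every real $\alpha>0$, $$\mathbf{ber}(T^*S)\ \ge\ \max\{\beta_1,\beta_2\},$$ where $$\beta_1=\frac{\csc\theta}{2\alpha}\Big(\big\||S+i\alpha T|^2\big\|_{ber}-\big\|S^*S+\alpha^2T^*T\big\|_{ber}\Big),$$ $$\beta_2=\frac{\csc\theta}{2\alpha}\Big(\big\|S^*S+\alpha^2T^*T\big\|_{ber}-\big\||S-i\alpha T|^2\big\|_{ber}\Big).$$
   Context: $\mathscr{H}$ is a complex separable reproducing kernel Hilbert space of complex-valued functions on a non-empty set $\mathscr{X}$: for every $\lambda\in\mathscr{X}$ evaluation at $\lambda$ is continuous, and $k_\lambda\in\mathscr{H}$ denotes the reproducing kernel, $\phi(\lambda)=\langle\phi,k_\lambda\rangle$ for all $\phi\in\mathscr{H}$. It is implicit that $k_\lambda\neq0$, and $\hat k_\lambda=k_\lambda/\|k_\lambda\|$. $\mathscr{B}(\mathscr{H})$ is the algebra of bounded linear operators on $\mathscr{H}$. For $A\in\mathscr{B}(\mathscr{H})$: $|A|=(A^*A)^{1/2}$; the Berezin transform is $\widetilde A(\lambda)=\langle A\hat k_\lambda,\hat k_\lambda\rangle$; the Berezin range is $\mathbf{Ber}(A)=\{\widetilde A(\lambda):\lambda\in\mathscr{X}\}$; the Berezin number is $\mathbf{ber}(A)=\sup_{\lambda\in\mathscr{X}}|\widetilde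 A(\lambda)|$; the Berezin norm is $\|A\|_{ber}=\sup_{\lambda,\mu\in\mathscr{X}}|\langle A\hat k_\lambda,\hat k_\mu\rangle|$. For $\theta\in[0,\frac{\pi}{2})$, $S_\theta=\{z\in\mathbb{C}:|\arg z|\le\theta\}$ is the sector with vertex at the origin (vertex included) and semi-angle $\theta$, and $\Pi^{\mathbf{Ber}}_\theta$ is the class of $A\in\mathscr{B}(\mathscr{H})$ with $\mathbf{Ber}(A)\subseteq S_\theta$. A known fact: $\|A\|_{ber}=\mathbf{ber}(A)$ for positive operators $A$. *)

theory Defs
  imports "HOL-Analysis.Analysis" "HOL-Library.Function_Algebras"
begin

(* Sums, differences and 0 of vectors (functions 'x => complex) and of operators are the
   pointwise ones of Function_Algebras.  The pointwise product that theory also provides is never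
   used; operators are multiplied by composition. *)

type_synonym 'x vec = "'x \<Rightarrow> complex"
type_synonym 'x oper = "'x vec \<Rightarrow> 'x vec"

(* Functions on the set points R are total functions on 'x that vanish outside points R
   (required in rkhs below). *)
record 'x fun_space =
  points :: "'x set"
  vectors :: "'x vec set"
  ip :: "'x vec \<Rightarrow> 'x vec \<Rightarrow> complex"

definition cscale :: "complex \<Rightarrow> 'x vec \<Rightarrow> 'x vec" where
  "cscale c f = (\<lambda>x. c * f x)"

definition vnorm :: "'x fun_space \<Rightarrow> 'x vec \<Rightarrow> real" where
  "vnorm R f = sqrt (Re (ip R f f))"

definition function_subspace :: "'x fun_space \<Rightarrow> bool" where
  "function_subspace R \<longleftrightarrow>
     (\<forall>f\<in>vectors R. \<forall>x. x \<notin> points R \<longrightarrow> f x = 0) \<and>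
     0 \<in> vectors R \<and>
     (\<forall>f\<in>vectors R. \<forall>g\<in>vectors R. f + g \<in> vectors R) \<and>
     (\<forall>c. \<forall>f\<in>vectors R. cscale c f \<in> vectors R)"

definition inner_product_on :: "'x fun_space \<Rightarrow> bool" where
  "inner_product_on R \<longleftrightarrow>
     (\<forall>f\<in>vectors R. \<forall>g\<in>vectors R. \<forall>h\<in>vectors R. ip R (f + g) h = ip R f h + ip R g h) \<and>
     (\<forall>c. \<forall>f\<in>vectors R. \<forall>g\<in>vectors R. ip R (cscale c f) g = c * ip R f g) \<and>
     (\<forall>f\<in>vectors R. \<forall>g\<in>vectors R. ip R g f = cnj (ip R f g)) \<and>
     (\<forall>f\<in>vectors R. 0 \<le> Re (ip R f f)) \<and>
     (\<forall>f\<in>vectors R. ip R f f = 0 \<longrightarrow> f = 0)"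

definition complete_space_on :: "'x fun_space \<Rightarrow> bool" where
  "complete_space_on R \<longleftrightarrow>
     (\<forall>s :: nat \<Rightarrow> 'x vec.
        (\<forall>n. s n \<in> vectors R) \<and>
        (\<forall>e>0. \<exists>N. \<forall>m\<ge>N. \<forall>n\<ge>N. vnorm R (s m - s n) < e) \<longrightarrow>
        (\<exists>f\<in>vectors R. (\<lambda>n. vnorm R (s n - f)) \<longlonglongrightarrow> 0))"

definition separable_space_on :: "'x fun_space \<Rightarrow> bool" where
  "separable_space_on R \<longleftrightarrow>
     (\<exists>D\<subseteq>vectors R. countable D \<and> (\<forall>f\<in>vectors R. \<forall>e>0. \<exists>d\<in>D. vnorm R (f - d) < e))"

definition evaluation_continuous :: "'x fun_space \<Rightarrow> 'x \<Rightarrow> bool" where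
  "evaluation_continuous R l \<longleftrightarrow>
     (\<forall>f\<in>vectors R. \<forall>e>0. \<exists>d>0. \<forall>g\<in>vectors R. vnorm R (g - f) < d \<longrightarrow> cmod (g l - f l) < e)"

definition kernel :: "'x fun_space \<Rightarrow> 'x \<Rightarrow> 'x vec" where
  "kernel R l = (THE k. k \<in> vectors R \<and> (\<forall>f\<in>vectors R. f l = ip R f k))"

definition nkernel :: "'x fun_space \<Rightarrow> 'x \<Rightarrow> 'x vec" where
  "nkernel R l = cscale (complex_of_real (1 / vnorm R (kernel R l))) (kernel R l)"

(* The last conjunct is the standing assumption that makes the normalized kernels meaningful. *)
definition rkhs :: "'x fun_space \<Rightarrow> bool" where
  "rkhs R \<longleftrightarrow>
     points R \<noteq> {} \<and> function_subspace R \<and> inner_product_on R \<and>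
     complete_space_on R \<and> separable_space_on R \<and>
     (\<forall>l\<in>points R. evaluation_continuous R l) \<and>
     (\<forall>l\<in>points R. kernel R l \<noteq> 0)"

(* Operators are constrained on vectors R only; no notion below depends on the values elsewhere. *)
definition bounded_ops :: "'x fun_space \<Rightarrow> 'x oper set" where
  "bounded_ops R = {A.
     (\<forall>f\<in>vectors R. A f \<in> vectors R) \<and>
     (\<forall>f\<in>vectors R. \<forall>g\<in>vectors R. A (f + g) = A f + A g) \<and>
     (\<forall>c. \<forall>f\<in>vectors R. A (cscale c f) = cscale c (A f)) \<and>
     (\<exists>C. \<forall>f\<in>vectors R. vnorm R (A f) \<le> C * vnorm R f)}"

definition op_scale :: "complex \<Rightarrow> 'x oper \<Rightarrow> 'x oper" where
  "op_scale c A = (\<lambda>f. cscale c (A f))"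

definition adj :: "'x fun_space \<Rightarrow> 'x oper \<Rightarrow> 'x oper" where
  "adj R A = (\<lambda>g. THE h. h \<in> vectors R \<and> (\<forall>f\<in>vectors R. ip R (A f) g = ip R f h))"

definition positive_op :: "'x fun_space \<Rightarrow> 'x oper \<Rightarrow> bool" where
  "positive_op R A \<longleftrightarrow>
     A \<in> bounded_ops R \<and> (\<forall>f\<in>vectors R. Im (ip R (A f) f) = 0 \<and> 0 \<le> Re (ip R (A f) f))"

(* The positive square root of a positive operator is unique on vectors R; the choice made by SOME
   only concerns the values outside vectors R. *)
definition op_sqrt :: "'x fun_space \<Rightarrow> 'x oper \<Rightarrow> 'x oper" where
  "op_sqrt R P = (SOME Q. positive_op R Q \<and> (\<forall>f\<in>vectors R. Q (Q f) = P f))"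

definition op_abs :: "'x fun_space \<Rightarrow> 'x oper \<Rightarrow> 'x oper" where
  "op_abs R A = op_sqrt R (adj R A \<circ> A)"

definition berezin :: "'x fun_space \<Rightarrow> 'x oper \<Rightarrow> 'x \<Rightarrow> complex" where
  "berezin R A l = ip R (A (nkernel R l)) (nkernel R l)"

definition Ber :: "'x fun_space \<Rightarrow> 'x oper \<Rightarrow> complex set" where
  "Ber R A = berezin R A ` points R"

definition ber :: "'x fun_space \<Rightarrow> 'x oper \<Rightarrow> real" where
  "ber R A = (SUP l\<in>points R. cmod (berezin R A l))"

definition ber_norm :: "'x fun_space \<Rightarrow> 'x oper \<Rightarrow> real" where
  "ber_norm R A = (SUP (l, m)\<in>points R \<times> points R. cmod (ip R (A (nkernel R l)) (nkernel R m)))"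

(* Arg takes values in (-pi, pi] and Arg 0 = 0, so the vertex belongs to the sector. *)
definition sector :: "real \<Rightarrow> complex set" where
  "sector \<theta> = {z. \<bar>Arg z\<bar> \<le> \<theta>}"

definition Pi_Ber :: "'x fun_space \<Rightarrow> real \<Rightarrow> 'x oper set" where
  "Pi_Ber R \<theta> = {A \<in> bounded_ops R. Ber R A \<subseteq> sector \<theta>}"

definition csc :: "real \<Rightarrow> real" where
  "csc \<theta> = 1 / sin \<theta>"

end

theory Submission
  imports Defs
begin

text \<open>The operator identity \<open>|S \<plusminus> i\<alpha>T|\<^sup>2 = S\<^sup>*S + \<alpha>\<^sup>2 T\<^sup>*T \<plusminus> i\<alpha>(S\<^sup>*T - T\<^sup>*S)\<close> says that the Berezin transform of
  \<open>|S \<plusminus> i\<alpha>T|\<^sup>2\<close> differs from that of \<open>S\<^sup>*S + \<alpha>\<^sup>2 T\<^sup>*T\<close> by \<open>\<plusminus> 2\<alpha> Im z\<close>, where \<open>z\<close> is the Berezin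
  transform of \<open>T\<^sup>*S\<close>. In the sector \<open>\<bar>Im z\<bar> \<le> sin \<theta> \<bar>z\<bar>\<close>, and for positive operators the Berezin
  norm and the Berezin number agree.\<close>

text \<open>The vectors form a carrier set inside \<open>'x \<Rightarrow> complex\<close> with its
  own inner product, so the Hilbert space facts are proved relative to that carrier.
  \<open>kernel\<close> and \<open>adj\<close> are definite descriptions and \<open>op_sqrt\<close>
  is a choice; nothing can be said about them before existence is shown. The first two rest on Riesz
  representation, for evaluation at a point and for \<open>f \<mapsto> <A f, g>\<close>; the third
  rests on an iteration that builds a positive root of \<open>A* A\<close>. The comparison itself is
  pointwise in the kernel index. Passing to suprema requires bounded families, which Cauchy-Schwarz
  supplies because normalized kernels are unit vectors. The factor csc \<theta> / (2 \<alpha>) is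
  the reciprocal of the constant 2 \<alpha> sin \<theta> that the pointwise estimate
  produces.\<close>

locale hilbert_functions =
  fixes R :: "'x fun_space"
  assumes subspace: "function_subspace R"
    and inner: "inner_product_on R"
    and complete: "complete_space_on R"
begin

subsection \<open>Inner product and norm\<close>

abbreviation V :: "'x vec set" where "V \<equiv> vectors R"

abbreviation inn :: "'x vec \<Rightarrow> 'x vec \<Rightarrow> complex" where "inn \<equiv> ip R"

abbreviation nrm :: "'x vec \<Rightarrow> real" where "nrm \<equiv> vnorm R"

lemma zero_mem [simp]: "0 \<in> V"
  and add_mem [simp]: "f \<in> V \<Longrightarrow> g \<in> V \<Longrightarrow> f + g \<in> V"
  and scale_mem [simp]: "f \<in> V \<Longrightarrow> cscale c f \<in> V"
  using subspace by (auto simp: function_subspace_def)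

lemma diff_eq_add_cscale: "f - g = f + cscale (-1) g" for f g :: "'x vec"
  by (auto simp: cscale_def)

lemma cscale_one [simp]: "cscale 1 f = f"
  by (auto simp: cscale_def)

lemma diff_mem [simp]: "f \<in> V \<Longrightarrow> g \<in> V \<Longrightarrow> f - g \<in> V"
  by (metis diff_eq_add_cscale add_mem scale_mem)

lemmas inner_product_rules = inner[unfolded inner_product_on_def]

lemmas ip_add_left [simp] = inner_product_rules[THEN conjunct1, rule_format]
  and ip_scale_left [simp] =
    inner_product_rules[THEN conjunct2, THEN conjunct1, rule_format]
  and ip_cnj = inner_product_rules[THEN conjunct2, THEN conjunct2, THEN conjunct1, rule_format]
  and Re_ip_self_nonneg [simp] =
    inner_product_rules[THEN conjunct2, THEN conjunct2, THEN conjunct2, THEN conjunct1, rule_format]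
  and ip_self_eq_0D =
    inner_product_rules[THEN conjunct2, THEN conjunct2, THEN conjunct2, THEN conjunct2, rule_format]

lemma ip_diff_left [simp]:
  "f \<in> V \<Longrightarrow> g \<in> V \<Longrightarrow> h \<in> V \<Longrightarrow> inn (f - g) h = inn f h - inn g h"
  unfolding diff_eq_add_cscale by simp

lemma ip_zero_left [simp]: "g \<in> V \<Longrightarrow> inn 0 g = 0"
  using ip_diff_left[of 0 0 g] by simp

lemma ip_add_right [simp]:
  assumes "f \<in> V" "g \<in> V" "h \<in> V" shows "inn h (f + g) = inn h f + inn h g"
  using assms ip_cnj[of "f + g" h] ip_cnj[of f h] ip_cnj[of g h] by simp

lemma ip_scale_right [simp]:
  assumes "f \<in> V" "h \<in> V" shows "inn h (cscale c f) = cnj c * inn h f"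
  using assms ip_cnj[of "cscale c f" h] ip_cnj[of f h] by simp

lemma ip_diff_right [simp]:
  assumes "f \<in> V" "g \<in> V" "h \<in> V" shows "inn h (f - g) = inn h f - inn h g"
  using assms ip_cnj[of "f - g" h] ip_cnj[of f h] ip_cnj[of g h] by simp

lemma ip_zero_right [simp]: "g \<in> V \<Longrightarrow> inn g 0 = 0"
  using ip_cnj[of 0 g] by simp

lemma Im_ip_self [simp]: "f \<in> V \<Longrightarrow> Im (inn f f) = 0"
  using ip_cnj[of f f] by (simp add: complex_eq_iff)

lemma vnorm_sq: "f \<in> V \<Longrightarrow> (nrm f)\<^sup>2 = Re (inn f f)"
  by (simp add: vnorm_def)

lemma ip_self: "f \<in> V \<Longrightarrow> inn f f = of_real ((nrm f)\<^sup>2)"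
  by (simp add: complex_eq_iff vnorm_sq)

lemma vnorm_nonneg [simp]: "f \<in> V \<Longrightarrow> 0 \<le> nrm f"
  by (simp add: vnorm_def)

lemma vnorm_eq_0_iff: "f \<in> V \<Longrightarrow> nrm f = 0 \<longleftrightarrow> f = 0"
  by (metis ip_self ip_self_eq_0D ip_zero_left of_real_0 power_zero_numeral
      vnorm_def zero_complex.simps(1) real_sqrt_zero)

lemma vnorm_zero [simp]: "nrm 0 = 0"
  by (simp add: vnorm_eq_0_iff)

lemma vnorm_cscale: "f \<in> V \<Longrightarrow> nrm (cscale c f) = cmod c * nrm f"
proof -
  assume f: "f \<in> V"
  have "inn (cscale c f) (cscale c f) = (c * cnj c) * inn f f"
    using f by simp
  also have "\<dots> = of_real ((cmod c * nrm f)\<^sup>2)"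
    using f by (simp add: ip_self complex_norm_square[symmetric] power_mult_distrib)
  finally show ?thesis
    using f by (simp add: vnorm_def[of R "cscale c f"] real_sqrt_abs abs_mult)
qed

lemma vnorm_add_sq:
  assumes "f \<in> V" "g \<in> V"
  shows "(nrm (f + g))\<^sup>2 = (nrm f)\<^sup>2 + (nrm g)\<^sup>2 + 2 * Re (inn f g)"
  using assms ip_cnj[of f g] by (simp add: vnorm_sq)

lemma vnorm_diff_sq:
  assumes "f \<in> V" "g \<in> V"
  shows "(nrm (f - g))\<^sup>2 = (nrm f)\<^sup>2 + (nrm g)\<^sup>2 - 2 * Re (inn f g)"
  using assms ip_cnj[of f g] by (simp add: vnorm_sq)

lemma Cauchy_Schwarz:
  assumes f: "f \<in> V" and g: "g \<in> V"
  shows "cmod (inn f g) \<le> nrm f * nrm g"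
proof (cases "g = 0")
  case False
  define N where "N = (nrm g)\<^sup>2"
  have N: "N > 0"
    using False g by (simp add: N_def vnorm_eq_0_iff)
  \<comment> \<open>\<open>cscale t g\<close> is the orthogonal projection of f onto the line
    through g, the choice that minimises the norm below.\<close>
  define t where "t = inn f g / of_real N"
  have "0 \<le> (nrm (f - cscale t g))\<^sup>2"
    by simp
  also have "\<dots> = (nrm f)\<^sup>2 + (cmod t)\<^sup>2 * N - 2 * Re (cnj t * inn f g)"
    using f g by (simp add: vnorm_diff_sq vnorm_cscale power_mult_distrib N_def)
  also have "cnj t * inn f g = of_real ((cmod (inn f g))\<^sup>2 / N)"
    by (simp add: t_def complex_norm_square mult.commute del: of_real_power)
  also have "(cmod t)\<^sup>2 * N = (cmod (inn f g))\<^sup>2 / N"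
    using N by (simp add: t_def norm_divide power_divide power2_eq_square)
  finally have "(cmod (inn f g))\<^sup>2 / N \<le> (nrm f)\<^sup>2"
    by simp
  then have "(cmod (inn f g))\<^sup>2 \<le> (nrm f * nrm g)\<^sup>2"
    using N by (simp add: N_def power_mult_distrib divide_le_eq)
  then show ?thesis
    using f g by (meson mult_nonneg_nonneg power2_le_imp_le vnorm_nonneg)
qed (use f in simp)

lemma vnorm_triangle:
  assumes f: "f \<in> V" and g: "g \<in> V"
  shows "nrm (f + g) \<le> nrm f + nrm g"
proof (rule power2_le_imp_le)
  have "Re (inn f g) \<le> nrm f * nrm g"
    using Cauchy_Schwarz[OF f g] complex_Re_le_cmod order_trans by blast
  then show "(nrm (f + g))\<^sup>2 \<le> (nrm f + nrm g)\<^sup>2"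
    using f g by (simp add: vnorm_add_sq power2_sum)
qed (use f g in simp)

lemma vnorm_diff_commute: "f \<in> V \<Longrightarrow> g \<in> V \<Longrightarrow> nrm (f - g) = nrm (g - f)"
  by (simp add: vnorm_def algebra_simps)

lemma vnorm_triangle_diff:
  assumes "f \<in> V" "g \<in> V" "h \<in> V"
  shows "nrm (f - h) \<le> nrm (f - g) + nrm (g - h)"
  using vnorm_triangle[of "f - g" "g - h"] assms by simp

lemma vnorm_diff_ge:
  assumes "f \<in> V" "g \<in> V"
  shows "\<bar>nrm f - nrm g\<bar> \<le> nrm (f - g)"
  using vnorm_triangle[of "f - g" g] vnorm_triangle[of "g - f" f] vnorm_diff_commute[of f g] assms
  by simp

lemma ip_right_cancel:
  assumes "g \<in> V" "h \<in> V" and eq: "\<And>f. f \<in> V \<Longrightarrow> inn f g = inn f h"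
  shows "g = h"
  using ip_self_eq_0D[of "g - h"] eq[of "g - h"] assms(1,2) by simp

section \<open>Convergence in norm\<close>

definition converges_to :: "(nat \<Rightarrow> 'x vec) \<Rightarrow> 'x vec \<Rightarrow> bool" where
  "converges_to s f \<longleftrightarrow> (\<lambda>n. nrm (s n - f)) \<longlonglongrightarrow> 0"

lemma Cauchy_converges:
  assumes "\<And>n. s n \<in> V"
    and "\<And>e. e > 0 \<Longrightarrow> \<exists>N. \<forall>m\<ge>N. \<forall>n\<ge>N. nrm (s m - s n) < e"
  obtains f where "f \<in> V" "converges_to s f"
  using complete assms unfolding complete_space_on_def converges_to_def by blast

text \<open>Uniqueness of limits in the form in which limits get identified: the error against the
  candidate g only has to lie below some real null sequence b. It yields linearity of limit
  operators and the fixed-point equation of the square root.\<close>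

lemma converges_to_eqI:
  assumes s: "\<And>n. s n \<in> V" and f: "f \<in> V" and "converges_to s f"
    and b: "b \<longlonglongrightarrow> 0" and le: "\<And>n. nrm (s n - g) \<le> b n" and g: "g \<in> V"
  shows "f = g"
proof -
  have "(\<lambda>n. nrm (s n - f) + b n) \<longlonglongrightarrow> 0"
    using tendsto_add[OF _ b] assms(3) by (force simp: converges_to_def)
  moreover have "nrm (f - g) \<le> nrm (s n - f) + b n" for n
    using vnorm_triangle_diff[of f "s n" g] s f g le[of n] vnorm_diff_commute[of f "s n"]
    by (smt (verit))
  ultimately have "nrm (f - g) \<le> 0"
    by (intro LIMSEQ_le_const) auto
  then show ?thesis
    using f g vnorm_nonneg[of "f - g"] vnorm_eq_0_iff[of "f - g"]
    by (metis diff_mem eq_iff_diff_eq_0 order_antisym)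
qed

lemma converges_to_vnorm:
  assumes "\<And>n. s n \<in> V" "f \<in> V" "converges_to s f"
  shows "(\<lambda>n. nrm (s n)) \<longlonglongrightarrow> nrm f"
  using assms(3) unfolding converges_to_def
  by (subst LIM_zero_iff[symmetric], elim Lim_null_comparison[rotated])
    (use assms vnorm_diff_ge in auto)

lemma converges_to_functional:
  assumes s: "\<And>n. s n \<in> V" "f \<in> V" "converges_to s f"
    and diff: "\<And>f g. f \<in> V \<Longrightarrow> g \<in> V \<Longrightarrow> \<phi> (f - g) = \<phi> f - \<phi> g"
    and bd: "\<And>f. f \<in> V \<Longrightarrow> cmod (\<phi> f) \<le> C * nrm f"
  shows "(\<lambda>n. \<phi> (s n)) \<longlonglongrightarrow> \<phi> f"
proof -
  have "(\<lambda>n. C * nrm (s n - f)) \<longlonglongrightarrow> 0"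
    using tendsto_mult_left[of _ 0 _ C] s(3) by (simp add: converges_to_def)
  then have "(\<lambda>n. \<phi> (s n) - \<phi> f) \<longlonglongrightarrow> 0"
  proof (rule Lim_null_comparison[rotated], intro always_eventually allI)
    show "cmod (\<phi> (s n) - \<phi> f) \<le> C * nrm (s n - f)" for n
      using bd[of "s n - f"] diff[of "s n" f] s by simp
  qed
  then show ?thesis
    by (simp add: LIM_zero_iff)
qed

lemma converges_to_ip:
  assumes "\<And>n. s n \<in> V" "f \<in> V" "converges_to s f" "g \<in> V"
  shows "(\<lambda>n. inn (s n) g) \<longlonglongrightarrow> inn f g"
  using assms Cauchy_Schwarz
  by (intro converges_to_functional[where \<phi> = "\<lambda>f. inn f g" and C = "nrm g"])
    (auto simp: mult.commute)

subsection \<open>Riesz representation\<close>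

text \<open>The representing vector is the minimiser of \<open>\<parallel>f\<parallel>\<^sup>2 - 2 Re (\<phi> f)\<close>; by the
  parallelogram law every minimising sequence is Cauchy.\<close>

lemma Riesz_representation:
  assumes add: "\<And>f g. f \<in> V \<Longrightarrow> g \<in> V \<Longrightarrow> \<phi> (f + g) = \<phi> f + \<phi> g"
    and scale: "\<And>c f. f \<in> V \<Longrightarrow> \<phi> (cscale c f) = c * \<phi> f"
    and bd: "\<And>f. f \<in> V \<Longrightarrow> cmod (\<phi> f) \<le> C * nrm f"
  shows "\<exists>!h. h \<in> V \<and> (\<forall>f\<in>V. \<phi> f = inn f h)"
proof -
  \<comment> \<open>If \<phi> is \<open><., h>\<close>, then F f = ||f - h||^2 - ||h||^2, so h is
    the only possible minimiser.\<close>
  define F where "F f = (nrm f)\<^sup>2 - 2 * Re (\<phi> f)" for f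
  have diff: "\<phi> (f - g) = \<phi> f - \<phi> g" if "f \<in> V" "g \<in> V" for f g
    using that by (simp add: diff_eq_add_cscale[of f g] add scale)
  \<comment> \<open>Completing the square: F f >= ||f||^2 - 2 C ||f|| = (||f|| - C)^2 - C^2.\<close>
  have below: "- C\<^sup>2 \<le> F f" if "f \<in> V" for f
  proof -
    have "Re (\<phi> f) \<le> C * nrm f"
      using bd[OF that] complex_Re_le_cmod order_trans by blast
    moreover have "0 \<le> (nrm f - C)\<^sup>2"
      by simp
    ultimately show ?thesis
      by (simp add: F_def power2_diff mult.commute)
  qed
  define m where "m = Inf (F ` V)"
  have bdd: "bdd_below (F ` V)"
    using below by (auto intro!: bdd_belowI2)
  have m_le: "m \<le> F f" if "f \<in> V" for f
    unfolding m_def using bdd that by (rule cINF_lower)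
  have "\<exists>f\<in>V. F f < m + 1 / real (Suc n)" for n
  proof -
    have "Inf (F ` V) < m + 1 / real (Suc n)"
      by (simp add: m_def)
    then show ?thesis
      using cINF_less_iff[OF _ bdd] zero_mem by (metis empty_iff)
  qed
  then obtain s where s: "\<And>n. s n \<in> V" and sm: "\<And>n. F (s n) < m + 1 / real (Suc n)"
    by metis
  \<comment> \<open>The parallelogram law reads ||f - g||^2 = 2 F f + 2 F g - 4 F ((f + g)/2), since
    the linear terms cancel; the midpoint value is at least m.\<close>
  have par: "(nrm (f - g))\<^sup>2 \<le> 2 * (F f - m) + 2 * (F g - m)" if "f \<in> V" "g \<in> V" for f g
  proof -
    have "m \<le> F (cscale (1/2) (f + g))"
      using that by (intro m_le) simp
    also have "\<dots> = (nrm (f + g))\<^sup>2 / 4 - Re (\<phi> f) - Re (\<phi> g)"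
      using that by (simp add: F_def vnorm_cscale scale add power_divide field_simps)
    finally show ?thesis
      using that by (simp add: F_def vnorm_add_sq vnorm_diff_sq field_simps)
  qed
  have "\<exists>N. \<forall>i\<ge>N. \<forall>j\<ge>N. nrm (s i - s j) < e" if e: "e > 0" for e
  proof -
    \<comment> \<open>The weights 2 + 2 in \<open>par\<close> call for an excess below e^2/4 at each
      of the two indices.\<close>
    obtain N where N: "1 / real (Suc N) < e\<^sup>2 / 4"
      using e nat_approx_posE[of "e\<^sup>2 / 4"] by auto
    have "nrm (s i - s j) < e" if "i \<ge> N" "j \<ge> N" for i j
    proof -
      have "F (s k) - m < e\<^sup>2 / 4" if "k \<ge> N" for k
      proof -
        have "1 / real (Suc k) \<le> 1 / real (Suc N)"
          using that by (intro divide_left_mono) auto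
        then show ?thesis
          using sm[of k] N by linarith
      qed
      from this[OF that(1)] this[OF that(2)]
      have "2 * (F (s i) - m) + 2 * (F (s j) - m) < e\<^sup>2"
        by argo
      then have "(nrm (s i - s j))\<^sup>2 < e\<^sup>2"
        by (rule le_less_trans[OF par[OF s s]])
      then show ?thesis
        using e by (simp add: power2_less_imp_less)
    qed
    then show ?thesis
      by blast
  qed
  then obtain h where h: "h \<in> V" and sh: "converges_to s h"
    using Cauchy_converges[of s] s by blast
  have "(\<lambda>n. F (s n)) \<longlonglongrightarrow> F h"
    unfolding F_def
    by (intro tendsto_intros converges_to_vnorm[OF s h sh]
        converges_to_functional[OF s h sh diff bd])
  moreover have "(\<lambda>n. m + 1 / real (Suc n)) \<longlonglongrightarrow> m + 0"
    by (intro tendsto_intros LIMSEQ_Suc lim_1_over_n)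
  ultimately have Fh: "F h \<le> m"
    using sm by (intro LIMSEQ_le[where Y = "\<lambda>n. m + 1 / real (Suc n)"]) (auto intro: less_imp_le)
  have Re_eq: "Re (\<phi> g) = Re (inn g h)" if g: "g \<in> V" for g
  proof -
    define d where "d = Re (inn g h) - Re (\<phi> g)"
    define N where "N = (nrm g)\<^sup>2"
    \<comment> \<open>First variation along g: F (h + t g) = F h + t^2 N + 2 t d. The quadratic is
      smallest at -d/N; the denominator N + 1 still makes it negative for nonzero d and also covers
      N = 0.\<close>
    define t where "t = - d / (N + 1)"
    have N: "N \<ge> 0"
      by (simp add: N_def)
    have "F h \<le> F (h + cscale (of_real t) g)"
      using Fh m_le[of "h + cscale (of_real t) g"] g h by simp
    also have "\<dots> = F h + t\<^sup>2 * N + 2 * t * d"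
      using g h ip_cnj[of g h]
      by (simp add: F_def vnorm_add_sq vnorm_cscale add scale d_def N_def power_mult_distrib
          algebra_simps)
    finally have "0 \<le> (t\<^sup>2 * N + 2 * t * d) * (N + 1)\<^sup>2"
      by simp
    also have "\<dots> = - (d\<^sup>2 * (N + 2))"
    proof -
      have t: "t * (N + 1) = - d"
        using N by (simp add: t_def)
      have "(t\<^sup>2 * N + 2 * t * d) * (N + 1)\<^sup>2
          = (t * (N + 1))\<^sup>2 * N + 2 * (t * (N + 1)) * d * (N + 1)"
        by (simp add: power2_eq_square algebra_simps)
      also have "\<dots> = - (d\<^sup>2 * (N + 2))"
        unfolding t by (simp add: power2_eq_square algebra_simps)
      finally show ?thesis .
    qed
    finally have "d\<^sup>2 * (N + 2) \<le> 0"
      by simp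
    then have "d = 0"
      using N by (auto simp: mult_le_0_iff)
    then show ?thesis
      by (simp add: d_def)
  qed
  \<comment> \<open>Real parts at \<open>cscale \<i> g\<close> are the negated imaginary parts at
    g.\<close>
  have "\<phi> g = inn g h" if g: "g \<in> V" for g
    using Re_eq[OF g] Re_eq[of "cscale \<i> g"] g h by (simp add: scale complex_eq_iff)
  then show ?thesis
    using h ip_right_cancel by (intro ex1I[of _ h]) auto
qed

subsection \<open>Bounded operators and adjoints\<close>

lemma bounded_opsI:
  assumes "\<And>f. f \<in> V \<Longrightarrow> A f \<in> V"
    and "\<And>f g. f \<in> V \<Longrightarrow> g \<in> V \<Longrightarrow> A (f + g) = A f + A g"
    and "\<And>c f. f \<in> V \<Longrightarrow> A (cscale c f) = cscale c (A f)"
    and "\<And>f. f \<in> V \<Longrightarrow> nrm (A f) \<le> C * nrm f"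
  shows "A \<in> bounded_ops R"
  using assms unfolding bounded_ops_def by blast

lemma bounded_ops_mem [simp]: "A \<in> bounded_ops R \<Longrightarrow> f \<in> V \<Longrightarrow> A f \<in> V"
  and bounded_ops_add: "A \<in> bounded_ops R \<Longrightarrow> f \<in> V \<Longrightarrow> g \<in> V \<Longrightarrow> A (f + g) = A f + A g"
  and bounded_ops_cscale: "A \<in> bounded_ops R \<Longrightarrow> f \<in> V \<Longrightarrow> A (cscale c f) = cscale c (A f)"
  unfolding bounded_ops_def by blast+

lemma bounded_ops_diff:
  "A \<in> bounded_ops R \<Longrightarrow> f \<in> V \<Longrightarrow> g \<in> V \<Longrightarrow> A (f - g) = A f - A g"
  unfolding diff_eq_add_cscale by (simp add: bounded_ops_add[of A] bounded_ops_cscale[of A])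

lemma bounded_ops_bound:
  assumes "A \<in> bounded_ops R"
  obtains C where "C > 0" "\<And>f. f \<in> V \<Longrightarrow> nrm (A f) \<le> C * nrm f"
proof -
  obtain C where C: "\<And>f. f \<in> V \<Longrightarrow> nrm (A f) \<le> C * nrm f"
    using assms unfolding bounded_ops_def by blast
  have "nrm (A f) \<le> (\<bar>C\<bar> + 1) * nrm f" if "f \<in> V" for f
    using C[OF that] mult_right_mono[of C "\<bar>C\<bar> + 1" "nrm f"] that
    by (smt (verit) vnorm_nonneg)
  then show ?thesis
    using that[of "\<bar>C\<bar> + 1"] by simp
qed

lemma cscale_add_right: "cscale c (f + g) = cscale c f + cscale c g"
  and cscale_diff_right: "cscale c (f - g) = cscale c f - cscale c g"
  and cscale_cscale: "cscale c (cscale d f) = cscale (c * d) f"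
  by (auto simp: cscale_def algebra_simps)

lemma id_bounded_ops [simp]: "id \<in> bounded_ops R"
  by (rule bounded_opsI[where C = 1]) auto

lemma zero_bounded_ops [simp]: "0 \<in> bounded_ops R"
  by (rule bounded_opsI[where C = 0]) (auto simp: cscale_def)

lemma add_bounded_ops [simp]:
  assumes A: "A \<in> bounded_ops R" and B: "B \<in> bounded_ops R"
  shows "A + B \<in> bounded_ops R"
proof -
  obtain C where C: "\<And>f. f \<in> V \<Longrightarrow> nrm (A f) \<le> C * nrm f"
    using A bounded_ops_bound by metis
  obtain D where D: "\<And>f. f \<in> V \<Longrightarrow> nrm (B f) \<le> D * nrm f"
    using B bounded_ops_bound by metis
  show ?thesis
  proof (rule bounded_opsI[where C = "C + D"])
    show "nrm ((A + B) f) \<le> (C + D) * nrm f" if "f \<in> V" for f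
      using C[OF that] D[OF that] vnorm_triangle[of "A f" "B f"] A B that
      by (simp add: algebra_simps)
  qed (use A B in \<open>simp_all add: bounded_ops_add[of A] bounded_ops_add[of B] bounded_ops_cscale[of A]
      bounded_ops_cscale[of B] cscale_add_right add_ac\<close>)
qed

lemma comp_bounded_ops [simp]:
  assumes A: "A \<in> bounded_ops R" and B: "B \<in> bounded_ops R"
  shows "A \<circ> B \<in> bounded_ops R"
proof -
  obtain C where C: "C > 0" "\<And>f. f \<in> V \<Longrightarrow> nrm (A f) \<le> C * nrm f"
    using A bounded_ops_bound by metis
  obtain D where D: "\<And>f. f \<in> V \<Longrightarrow> nrm (B f) \<le> D * nrm f"
    using B bounded_ops_bound by metis
  show ?thesis
  proof (rule bounded_opsI[where C = "C * D"])
    show "nrm ((A \<circ> B) f) \<le> C * D * nrm f" if "f \<in> V" for f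
    proof -
      have "nrm (A (B f)) \<le> C * nrm (B f)"
        using C B that by simp
      also have "\<dots> \<le> C * (D * nrm f)"
        using C(1) D[OF that] by (intro mult_left_mono) auto
      finally show ?thesis
        by (simp add: mult.assoc)
    qed
  qed (use A B in \<open>simp_all add: bounded_ops_add[of A] bounded_ops_add[of B] bounded_ops_cscale[of A]
      bounded_ops_cscale[of B]\<close>)
qed

lemma op_scale_bounded_ops [simp]:
  assumes A: "A \<in> bounded_ops R"
  shows "op_scale c A \<in> bounded_ops R"
proof -
  obtain C where C: "\<And>f. f \<in> V \<Longrightarrow> nrm (A f) \<le> C * nrm f"
    using A bounded_ops_bound by metis
  show ?thesis
  proof (rule bounded_opsI[where C = "cmod c * C"])
    show "nrm (op_scale c A f) \<le> cmod c * C * nrm f" if "f \<in> V" for f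
      using mult_left_mono[OF C[OF that], of "cmod c"] A that
      by (simp add: op_scale_def vnorm_cscale)
  qed (use A in \<open>simp_all add: op_scale_def bounded_ops_add[of A] bounded_ops_cscale[of A] cscale_add_right
      cscale_cscale mult.commute\<close>)
qed

lemma diff_bounded_ops [simp]:
  assumes "A \<in> bounded_ops R" "B \<in> bounded_ops R"
  shows "A - B \<in> bounded_ops R"
proof -
  have "A - B = A + op_scale (-1) B"
    by (auto simp: op_scale_def cscale_def fun_eq_iff)
  then show ?thesis
    using assms by (simp only: add_bounded_ops op_scale_bounded_ops)
qed

lemma adj_mem_and_ip:
  assumes A: "A \<in> bounded_ops R" and g: "g \<in> V"
  shows "adj R A g \<in> V \<and> (\<forall>f\<in>V. inn (A f) g = inn f (adj R A g))"
proof -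
  obtain C where C: "\<And>f. f \<in> V \<Longrightarrow> nrm (A f) \<le> C * nrm f"
    using A bounded_ops_bound by metis
  have "\<exists>!h. h \<in> V \<and> (\<forall>f\<in>V. inn (A f) g = inn f h)"
  proof (rule Riesz_representation[where C = "C * nrm g"])
    show "cmod (inn (A f) g) \<le> C * nrm g * nrm f" if "f \<in> V" for f
      using Cauchy_Schwarz[of "A f" g] mult_right_mono[OF C[OF that], of "nrm g"] A g that
      by (simp add: mult_ac)
  qed (use A g in \<open>simp_all add: bounded_ops_add[of A] bounded_ops_cscale[of A]\<close>)
  then show ?thesis
    unfolding adj_def by (rule theI')
qed

lemma adj_mem [simp]: "A \<in> bounded_ops R \<Longrightarrow> g \<in> V \<Longrightarrow> adj R A g \<in> V"
  using adj_mem_and_ip by blast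

lemma ip_adj_right: "A \<in> bounded_ops R \<Longrightarrow> f \<in> V \<Longrightarrow> g \<in> V \<Longrightarrow> inn f (adj R A g) = inn (A f) g"
  using adj_mem_and_ip by metis

lemma ip_adj_left: "A \<in> bounded_ops R \<Longrightarrow> f \<in> V \<Longrightarrow> g \<in> V \<Longrightarrow> inn (adj R A f) g = inn f (A g)"
  using ip_adj_right[of A g f] ip_cnj[of g "adj R A f"] ip_cnj[of "A g" f] by simp

text \<open>With h = A* g one has ||h||^2 = <A h, g> <= C ||h|| ||g||, and ||h|| cancels. The
  adjoint keeps the very constant of A, which the contraction estimate for the square root relies
  on.\<close>

lemma adj_vnorm_le:
  assumes A: "A \<in> bounded_ops R" and g: "g \<in> V"
    and C: "\<And>f. f \<in> V \<Longrightarrow> nrm (A f) \<le> C * nrm f"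
  shows "nrm (adj R A g) \<le> C * nrm g"
proof (cases "nrm (adj R A g) = 0")
  case True
  then show ?thesis
    \<comment> \<open>The sign of C is open, so 0 <= C ||g|| is read off from ||A g|| <= C
      ||g||.\<close>
    using C[OF g] vnorm_nonneg[of "A g"] A g by (metis bounded_ops_mem order_trans)
next
  case False
  let ?h = "adj R A g"
  have "(nrm ?h)\<^sup>2 = Re (inn (A ?h) g)"
    using A g by (simp add: vnorm_sq ip_adj_right)
  also have "\<dots> \<le> nrm (A ?h) * nrm g"
    using Cauchy_Schwarz[of "A ?h" g] A g complex_Re_le_cmod order_trans by (meson adj_mem bounded_ops_mem)
  also have "\<dots> \<le> C * nrm ?h * nrm g"
    using A g C by (intro mult_right_mono) auto
  finally have "nrm ?h * nrm ?h \<le> (C * nrm g) * nrm ?h"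
    by (simp add: power2_eq_square mult_ac)
  moreover have "nrm ?h > 0"
    using False vnorm_nonneg[of ?h] A g by (simp add: order_less_le)
  ultimately show ?thesis
    by simp
qed

lemma adj_bounded_ops [simp]:
  assumes A: "A \<in> bounded_ops R"
  shows "adj R A \<in> bounded_ops R"
proof -
  obtain C where C: "\<And>f. f \<in> V \<Longrightarrow> nrm (A f) \<le> C * nrm f"
    using A bounded_ops_bound by metis
  show ?thesis
  proof (rule bounded_opsI)
    show "adj R A (f + g) = adj R A f + adj R A g" if "f \<in> V" "g \<in> V" for f g
      using A that by (intro ip_right_cancel) (simp_all add: ip_adj_right)
    show "adj R A (cscale c f) = cscale c (adj R A f)" if "f \<in> V" for c f
      using A that by (intro ip_right_cancel) (simp_all add: ip_adj_right)
    show "nrm (adj R A g) \<le> C * nrm g" if "g \<in> V" for g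
      using adj_vnorm_le[OF A that C] .
  qed (use A in simp)
qed

subsection \<open>Square roots of positive operators\<close>

text \<open>The limit in the square-root construction is obtained vector by vector; this makes it an
  operator again. Linearity passes through the errors at single vectors, boundedness through the
  common constant.\<close>

lemma bounded_ops_converges:
  assumes Y: "\<And>n. Y n \<in> bounded_ops R"
    and bd: "\<And>n f. f \<in> V \<Longrightarrow> nrm (Y n f) \<le> C * nrm f"
    and lim: "\<And>f. f \<in> V \<Longrightarrow> Z f \<in> V \<and> converges_to (\<lambda>n. Y n f) (Z f)"
  shows "Z \<in> bounded_ops R"
proof (rule bounded_opsI)
  have lim0: "(\<lambda>n. nrm (Y n f - Z f)) \<longlonglongrightarrow> 0" if "f \<in> V" for f
    using lim[OF that] by (simp add: converges_to_def)
  show "Z (f + g) = Z f + Z g" if f: "f \<in> V" and g: "g \<in> V" for f g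
  proof (rule converges_to_eqI[where s = "\<lambda>n. Y n (f + g)"])
    show "(\<lambda>n. nrm (Y n f - Z f) + nrm (Y n g - Z g)) \<longlonglongrightarrow> 0"
      using tendsto_add[OF lim0[OF f] lim0[OF g]] by simp
    show "nrm (Y n (f + g) - (Z f + Z g)) \<le> nrm (Y n f - Z f) + nrm (Y n g - Z g)" for n
    proof -
      have "Y n (f + g) - (Z f + Z g) = (Y n f - Z f) + (Y n g - Z g)"
        using bounded_ops_add[OF Y f g] by (simp add: algebra_simps)
      then show ?thesis
        using vnorm_triangle[of "Y n f - Z f" "Y n g - Z g"] Y f g lim
        by (simp only: diff_mem bounded_ops_mem)
    qed
  qed (use Y f g lim in simp_all)
  show "Z (cscale c f) = cscale c (Z f)" if f: "f \<in> V" for c f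
  proof (rule converges_to_eqI[where s = "\<lambda>n. Y n (cscale c f)"])
    show "(\<lambda>n. cmod c * nrm (Y n f - Z f)) \<longlonglongrightarrow> 0"
      using tendsto_mult_left[OF lim0[OF f], of "cmod c"] by simp
    show "nrm (Y n (cscale c f) - cscale c (Z f)) \<le> cmod c * nrm (Y n f - Z f)" for n
    proof -
      have "Y n (cscale c f) - cscale c (Z f) = cscale c (Y n f - Z f)"
        using bounded_ops_cscale[OF Y f] by (simp add: cscale_diff_right)
      then show ?thesis
        using Y f lim by (simp add: vnorm_cscale)
    qed
  qed (use Y f lim in simp_all)
  show "nrm (Z f) \<le> C * nrm f" if f: "f \<in> V" for f
    using converges_to_vnorm[of "\<lambda>n. Y n f" "Z f"] Y f lim bd[OF f]
    by (intro LIMSEQ_le_const2[of "\<lambda>n. nrm (Y n f)"]) auto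
qed (use lim in simp)

text \<open>For \<open>B = 1 - P\<close>, \<open>sqrt_iterate\<close> is the recursive approximation to the solution \<open>Y = 1 - \<surd>P\<close> of
  \<open>2 Y = B + Y\<^sup>2\<close>. Its scalar instance \<open>B = 1\<close> is \<open>sqrt_majorant\<close>, and differences of the
  operator iterates are bounded in norm by the corresponding scalar differences.\<close>

primrec sqrt_iterate :: "'x oper \<Rightarrow> nat \<Rightarrow> 'x oper" where
  "sqrt_iterate B 0 = 0"
| "sqrt_iterate B (Suc n) = op_scale (1/2) (B + (sqrt_iterate B n \<circ> sqrt_iterate B n))"

primrec sqrt_majorant :: "nat \<Rightarrow> real" where
  "sqrt_majorant 0 = 0"
| "sqrt_majorant (Suc n) = (1 + (sqrt_majorant n)\<^sup>2) / 2"

lemma sqrt_majorant_bounds: "0 \<le> sqrt_majorant n" "sqrt_majorant n \<le> 1"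
proof -
  have "0 \<le> sqrt_majorant n \<and> sqrt_majorant n \<le> 1"
    by (induction n) (auto simp: power_le_one)
  then show "0 \<le> sqrt_majorant n" "sqrt_majorant n \<le> 1"
    by auto
qed

lemma incseq_sqrt_majorant: "incseq sqrt_majorant"
proof (rule incseq_SucI)
  show "sqrt_majorant n \<le> sqrt_majorant (Suc n)" for n
    \<comment> \<open>One step increases the majorant q by (q - 1)^2 / 2.\<close>
    using zero_le_power2[of "sqrt_majorant n - 1"] by (simp add: power2_diff)
qed

lemma Cauchy_sqrt_majorant: "Cauchy sqrt_majorant"
  using incseq_convergent[OF incseq_sqrt_majorant] sqrt_majorant_bounds(2)
  by (metis LIMSEQ_imp_Cauchy)

context
  fixes B :: "'x oper"
  assumes B: "B \<in> bounded_ops R" and contraction: "\<And>f. f \<in> V \<Longrightarrow> nrm (B f) \<le> nrm f"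
begin

lemma sqrt_iterate_bounded_ops [simp]: "sqrt_iterate B n \<in> bounded_ops R"
proof (induction n)
  case 0
  show ?case
    unfolding sqrt_iterate.simps by (rule zero_bounded_ops)
qed (use B in simp)

lemma sqrt_iterate_Suc:
  "sqrt_iterate B (Suc n) f = cscale (1/2) (B f + sqrt_iterate B n (sqrt_iterate B n f))"
  by (simp add: op_scale_def)

lemma sqrt_iterate_vnorm_le: "f \<in> V \<Longrightarrow> nrm (sqrt_iterate B n f) \<le> sqrt_majorant n * nrm f"
proof (induction n arbitrary: f)
  case (Suc n)
  let ?Y = "sqrt_iterate B n" and ?q = "sqrt_majorant n"
  have "nrm (?Y (?Y f)) \<le> ?q * nrm (?Y f)"
    using Suc by simp
  also have "\<dots> \<le> ?q * (?q * nrm f)"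
    using Suc sqrt_majorant_bounds by (intro mult_left_mono) auto
  finally have "nrm (B f + ?Y (?Y f)) \<le> nrm f + ?q\<^sup>2 * nrm f"
    using vnorm_triangle[of "B f" "?Y (?Y f)"] contraction[of f] Suc.prems B
    by (simp add: power2_eq_square)
  then show ?case
    using Suc.prems B unfolding sqrt_iterate_Suc
    by (simp add: vnorm_cscale algebra_simps)
qed simp

text \<open>Induction through Y^2 - Z^2 = Y (Y - Z) + (Y - Z) Z. With ||Y|| <= p, ||Z|| <= q and ||Y
  - Z|| <= p - q this gives p (p - q) + (p - q) q = p^2 - q^2, exactly the scalar recursion. The
  hypothesis is applied at f and at Z f, hence the generalisation over f.\<close>

lemma sqrt_iterate_diff_le:
  assumes "f \<in> V"
  shows "nrm (sqrt_iterate B (n + k) f - sqrt_iterate B n f)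
    \<le> (sqrt_majorant (n + k) - sqrt_majorant n) * nrm f"
  using assms
proof (induction n arbitrary: f)
  case 0
  then show ?case
    using sqrt_iterate_vnorm_le[of f k] by simp
next
  case (Suc n)
  let ?Y = "sqrt_iterate B (n + k)" and ?Z = "sqrt_iterate B n"
  let ?p = "sqrt_majorant (n + k)" and ?q = "sqrt_majorant n"
  have mono: "?q \<le> ?p"
    using incseq_sqrt_majorant by (simp add: incseq_def)
  have f: "f \<in> V" "?Y f \<in> V" "?Z f \<in> V"
    using Suc.prems by auto
  have "?Y (?Y f) - ?Z (?Z f) = ?Y (?Y f - ?Z f) + (?Y (?Z f) - ?Z (?Z f))"
    using f by (simp add: bounded_ops_diff[of ?Y])
  then have "nrm (?Y (?Y f) - ?Z (?Z f)) \<le> nrm (?Y (?Y f - ?Z f)) + nrm (?Y (?Z f) - ?Z (?Z f))"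
    using vnorm_triangle[of "?Y (?Y f - ?Z f)" "?Y (?Z f) - ?Z (?Z f)"] f
    by (simp only: diff_mem bounded_ops_mem sqrt_iterate_bounded_ops)
  also have "\<dots> \<le> ?p * nrm (?Y f - ?Z f) + (?p - ?q) * nrm (?Z f)"
    using f by (intro add_mono Suc.IH sqrt_iterate_vnorm_le diff_mem)
  also have "\<dots> \<le> ?p * ((?p - ?q) * nrm f) + (?p - ?q) * (?q * nrm f)"
    using mono sqrt_majorant_bounds
    by (intro add_mono mult_left_mono Suc.IH[OF f(1)] sqrt_iterate_vnorm_le[OF f(1)]) auto
  also have "\<dots> = (?p\<^sup>2 - ?q\<^sup>2) * nrm f"
    by (simp add: power2_eq_square algebra_simps)
  finally have le: "nrm (?Y (?Y f) - ?Z (?Z f)) \<le> (?p\<^sup>2 - ?q\<^sup>2) * nrm f" .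
  have "sqrt_iterate B (Suc (n + k)) f - sqrt_iterate B (Suc n) f
      = cscale (1/2) (?Y (?Y f) - ?Z (?Z f))"
    unfolding sqrt_iterate_Suc by (simp add: cscale_add_right cscale_diff_right)
  then have "nrm (sqrt_iterate B (Suc (n + k)) f - sqrt_iterate B (Suc n) f)
      = nrm (?Y (?Y f) - ?Z (?Z f)) / 2"
    using f by (simp add: vnorm_cscale del: sqrt_iterate.simps)
  also have "\<dots> \<le> (sqrt_majorant (Suc (n + k)) - sqrt_majorant (Suc n)) * nrm f"
    using le by (simp add: field_simps)
  finally show ?case
    by (simp only: add_Suc)
qed

lemma sqrt_iterate_limit:
  assumes f: "f \<in> V"
  shows "\<exists>g\<in>V. converges_to (\<lambda>n. sqrt_iterate B n f) g"
proof -
  let ?Y = "\<lambda>n. sqrt_iterate B n f" and ?q = sqrt_majorant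
  have le: "nrm (?Y i - ?Y j) \<le> \<bar>?q i - ?q j\<bar> * nrm f" if "j \<le> i" for i j
    using sqrt_iterate_diff_le[OF f, of j "i - j"] that incseq_sqrt_majorant
    by (simp add: incseq_def)
  have dist_le: "nrm (?Y i - ?Y j) \<le> \<bar>?q i - ?q j\<bar> * nrm f" for i j
    using le[of i j] le[of j i] f vnorm_diff_commute[of "?Y i" "?Y j"]
    by (cases "j \<le> i") (auto simp: abs_minus_commute)
  have "\<exists>N. \<forall>i\<ge>N. \<forall>j\<ge>N. nrm (?Y i - ?Y j) < e" if e: "e > 0" for e
  proof -
    \<comment> \<open>Adding 1 keeps the divisor positive when f = 0.\<close>
    have pos: "0 < nrm f + 1"
      using vnorm_nonneg[OF f] by simp
    then obtain N where N: "\<And>i j. i \<ge> N \<Longrightarrow> j \<ge> N \<Longrightarrow> \<bar>?q i - ?q j\<bar> < e / (nrm f + 1)"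
      using Cauchy_sqrt_majorant e unfolding Cauchy_def dist_real_def
      by (meson divide_pos_pos)
    have "nrm (?Y i - ?Y j) < e" if "i \<ge> N" "j \<ge> N" for i j
    proof -
      have "nrm (?Y i - ?Y j) \<le> \<bar>?q i - ?q j\<bar> * (nrm f + 1)"
        using dist_le[of i j] mult_left_mono[of "nrm f" "nrm f + 1" "\<bar>?q i - ?q j\<bar>"] by simp
      also have "\<dots> < e"
        using N[OF that] pos by (simp add: field_simps)
      finally show ?thesis .
    qed
    then show ?thesis
      by blast
  qed
  then show ?thesis
    using Cauchy_converges[of ?Y] f by (metis bounded_ops_mem sqrt_iterate_bounded_ops)
qed

lemma sqrt_iterate_symmetric:
  assumes sym: "\<And>f g. f \<in> V \<Longrightarrow> g \<in> V \<Longrightarrow> inn (B f) g = inn f (B g)"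
    and "f \<in> V" "g \<in> V"
  shows "inn (sqrt_iterate B n f) g = inn f (sqrt_iterate B n g)"
  using assms(2,3)
proof (induction n arbitrary: f g)
  case (Suc n)
  then show ?case
    using B unfolding sqrt_iterate_Suc by (simp add: sym)
qed simp

lemma sqrt_iterate_fixed_point:
  assumes sym: "\<And>f g. f \<in> V \<Longrightarrow> g \<in> V \<Longrightarrow> inn (B f) g = inn f (B g)"
  obtains Y where "Y \<in> bounded_ops R" "\<And>f. f \<in> V \<Longrightarrow> nrm (Y f) \<le> nrm f"
    "\<And>f. f \<in> V \<Longrightarrow> Y f = cscale (1/2) (B f + Y (Y f))"
    "\<And>f. f \<in> V \<Longrightarrow> Im (inn (Y f) f) = 0"
proof -
  let ?Y = "sqrt_iterate B"
  obtain Z where Z: "\<And>f. f \<in> V \<Longrightarrow> Z f \<in> V \<and> converges_to (\<lambda>n. ?Y n f) (Z f)"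
    using sqrt_iterate_limit by metis
  have bd: "nrm (?Y n f) \<le> 1 * nrm f" if "f \<in> V" for n f
    using sqrt_iterate_vnorm_le[OF that, of n] that
      mult_right_mono[OF sqrt_majorant_bounds(2)[of n] vnorm_nonneg[OF that]]
    by linarith
  have Zop: "Z \<in> bounded_ops R"
    using sqrt_iterate_bounded_ops bd Z by (rule bounded_ops_converges)
  have lim0: "(\<lambda>n. nrm (?Y n f - Z f)) \<longlonglongrightarrow> 0" if "f \<in> V" for f
    using Z[OF that] by (simp add: converges_to_def)
  show ?thesis
  proof (rule that[OF Zop])
    fix f assume f: "f \<in> V"
    show "nrm (Z f) \<le> nrm f"
      using converges_to_vnorm[of "\<lambda>n. ?Y n f" "Z f"] f Z bd[OF f]
      by (intro LIMSEQ_le_const2[of "\<lambda>n. nrm (?Y n f)"]) auto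
    show "Z f = cscale (1/2) (B f + Z (Z f))"
    proof (rule converges_to_eqI[where s = "\<lambda>n. ?Y (Suc n) f"])
      show "converges_to (\<lambda>n. ?Y (Suc n) f) (Z f)"
        using LIMSEQ_Suc[OF lim0[OF f]] by (simp add: converges_to_def del: sqrt_iterate.simps)
      show "(\<lambda>n. (nrm (?Y n f - Z f) + nrm (?Y n (Z f) - Z (Z f))) / 2) \<longlonglongrightarrow> 0"
        using tendsto_divide[OF tendsto_add[OF lim0[OF f] lim0[of "Z f"]] tendsto_const[of 2]] Z f
        by simp
      show "nrm (?Y (Suc n) f - cscale (1/2) (B f + Z (Z f)))
          \<le> (nrm (?Y n f - Z f) + nrm (?Y n (Z f) - Z (Z f))) / 2" for n
      proof -
        have mem: "?Y n f \<in> V" "Z f \<in> V" "?Y n (?Y n f) \<in> V" "?Y n (Z f) \<in> V" "Z (Z f) \<in> V"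
          using f Zop by auto
        have "?Y (Suc n) f - cscale (1/2) (B f + Z (Z f))
            = cscale (1/2) (?Y n (?Y n f) - Z (Z f))"
          unfolding sqrt_iterate_Suc by (simp add: cscale_add_right cscale_diff_right)
        \<comment> \<open>Both the operator and its argument vary with n. Inserting Y_n (Z f)
          separates them: the uniform bound handles the first part, convergence at the fixed vector
          Z f the second.\<close>
        moreover have "nrm (?Y n (?Y n f) - Z (Z f))
            \<le> nrm (?Y n (?Y n f) - ?Y n (Z f)) + nrm (?Y n (Z f) - Z (Z f))"
          using mem by (intro vnorm_triangle_diff)
        moreover have "nrm (?Y n (?Y n f) - ?Y n (Z f)) \<le> nrm (?Y n f - Z f)"
          using bd[of "?Y n f - Z f" n] mem by (simp add: bounded_ops_diff[of "?Y n"])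
        ultimately show ?thesis
          using mem by (simp add: vnorm_cscale del: sqrt_iterate.simps)
      qed
    qed (use f Zop B in \<open>simp_all del: sqrt_iterate.simps\<close>)
    have "Im (inn (?Y n f) f) = 0" for n
      using sqrt_iterate_symmetric[OF sym f f, of n] ip_cnj[of "?Y n f" f] f
      by (simp add: complex_eq_iff)
    moreover have "(\<lambda>n. Im (inn (?Y n f) f)) \<longlonglongrightarrow> Im (inn (Z f) f)"
      using f Z by (intro tendsto_intros converges_to_ip) auto
    ultimately show "Im (inn (Z f) f) = 0"
      by (simp add: LIMSEQ_const_iff)
  qed
qed

end

text \<open>Dividing P = A* A by C^2, with C a bound for A, makes B = 1 - P / C^2 a contraction. For
  the fixed point Y of 2 Y = B + Y^2, the operator Q = C (1 - Y) satisfies Q^2 = C^2 (1 - 2 Y + Y^2)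
  = C^2 (1 - B) = P.\<close>

lemma adj_comp_self_sqrt:
  assumes A: "A \<in> bounded_ops R"
  shows "\<exists>Q. positive_op R Q \<and> (\<forall>f\<in>V. Q (Q f) = (adj R A \<circ> A) f)"
proof -
  obtain C where C: "C > 0" "\<And>f. f \<in> V \<Longrightarrow> nrm (A f) \<le> C * nrm f"
    using A bounded_ops_bound by metis
  define P where "P = adj R A \<circ> A"
  define B where "B = id - op_scale (of_real (1 / C\<^sup>2)) P"
  have P: "P \<in> bounded_ops R"
    using A by (simp add: P_def)
  have ipP: "inn (P f) g = inn (A f) (A g)" "inn f (P g) = inn (A f) (A g)"
    if "f \<in> V" "g \<in> V" for f g
    using A that by (simp_all add: P_def ip_adj_left ip_adj_right)
  have Bf: "B f = f - cscale (of_real (1 / C\<^sup>2)) (P f)" for f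
    by (simp add: B_def op_scale_def)
  have B: "B \<in> bounded_ops R"
    using P by (simp add: B_def)
  \<comment> \<open>In the expansion of ||B f||^2 the term ||P f||^2 / C^4 is at most ||A f||^2 /
    C^2, so the cross term -2 ||A f||^2 / C^2 absorbs it.\<close>
  have contraction: "nrm (B f) \<le> nrm f" if f: "f \<in> V" for f
  proof (rule power2_le_imp_le)
    have "nrm (P f) \<le> C * nrm (A f)"
      using adj_vnorm_le[OF A _ C(2), of "A f"] A f by (simp add: P_def)
    then have "(nrm (P f))\<^sup>2 \<le> C\<^sup>2 * (nrm (A f))\<^sup>2"
      using P f by (metis power_mono power_mult_distrib bounded_ops_mem vnorm_nonneg)
    then have "(1 / C\<^sup>2)\<^sup>2 * (nrm (P f))\<^sup>2 \<le> (1 / C\<^sup>2)\<^sup>2 * (C\<^sup>2 * (nrm (A f))\<^sup>2)"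
      by (intro mult_left_mono) auto
    also have "\<dots> = (nrm (A f))\<^sup>2 / C\<^sup>2"
      using C(1) by (simp add: field_simps power2_eq_square)
    finally have "(1 / C\<^sup>2)\<^sup>2 * (nrm (P f))\<^sup>2 \<le> 2 * ((nrm (A f))\<^sup>2 / C\<^sup>2)"
      by (smt (verit) divide_nonneg_nonneg zero_le_power2)
    moreover have "(nrm (B f))\<^sup>2
        = (nrm f)\<^sup>2 + (1 / C\<^sup>2)\<^sup>2 * (nrm (P f))\<^sup>2 - 2 * ((nrm (A f))\<^sup>2 / C\<^sup>2)"
      using f P A unfolding Bf
      by (simp add: vnorm_diff_sq vnorm_cscale ipP ip_self power_mult_distrib power_divide
          norm_divide norm_power)
    ultimately show "(nrm (B f))\<^sup>2 \<le> (nrm f)\<^sup>2"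
      by simp
  qed (use f in simp)
  have sym: "inn (B f) g = inn f (B g)" if "f \<in> V" "g \<in> V" for f g
    using that P unfolding Bf by (simp add: ipP)
  obtain Y where Y: "Y \<in> bounded_ops R" and Y_le: "\<And>f. f \<in> V \<Longrightarrow> nrm (Y f) \<le> nrm f"
    and fix_eq: "\<And>f. f \<in> V \<Longrightarrow> Y f = cscale (1/2) (B f + Y (Y f))"
    and Y_real: "\<And>f. f \<in> V \<Longrightarrow> Im (inn (Y f) f) = 0"
    using sqrt_iterate_fixed_point[OF B contraction sym] by metis
  define Q where "Q = op_scale (of_real C) (id - Y)"
  have Qf: "Q f = cscale (of_real C) (f - Y f)" for f
    by (simp add: Q_def op_scale_def)
  have "positive_op R Q"
    unfolding positive_op_def
  proof (intro conjI ballI)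
    show "Q \<in> bounded_ops R"
      using Y by (simp add: Q_def)
    fix f assume f: "f \<in> V"
    \<comment> \<open>Positivity of 1 - Y: Y is a contraction, so its quadratic form stays below
      ||f||^2.\<close>
    have "Re (inn (Y f) f) \<le> nrm (Y f) * nrm f"
      using Cauchy_Schwarz[of "Y f" f] Y f complex_Re_le_cmod order_trans
      by (meson bounded_ops_mem)
    also have "\<dots> \<le> (nrm f)\<^sup>2"
      using Y_le[OF f] f by (simp add: power2_eq_square mult_right_mono)
    finally show "0 \<le> Re (inn (Q f) f)"
      using f Y C(1) by (simp add: Qf vnorm_sq)
    show "Im (inn (Q f) f) = 0"
      using f Y Y_real[OF f] by (simp add: Qf)
  qed
  moreover have "Q (Q f) = P f" if f: "f \<in> V" for f
  proof -
    have "Y (Q f) = cscale (of_real C) (Y (f - Y f))"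
      unfolding Qf using f Y by (intro bounded_ops_cscale[OF Y] diff_mem bounded_ops_mem[OF Y])
    then have "Q (Q f) = cscale (of_real C)
        (cscale (of_real C) (f - Y f) - cscale (of_real C) (Y (f - Y f)))"
      by (simp only: Qf)
    also have "\<dots> = cscale (of_real (C\<^sup>2)) ((f - Y f) - Y (f - Y f))"
      by (simp only: cscale_diff_right[symmetric] cscale_cscale power2_eq_square of_real_mult)
    also have "(f - Y f) - Y (f - Y f) = f - cscale 2 (Y f) + Y (Y f)"
      using f Y by (auto simp: bounded_ops_diff[of Y] cscale_def)
    also have "\<dots> = f - B f"
      by (subst fix_eq[OF f]) (simp add: cscale_cscale)
    also have "\<dots> = cscale (of_real (1 / C\<^sup>2)) (P f)"
      by (simp add: Bf)
    finally show ?thesis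
      using C(1) by (simp add: cscale_cscale)
  qed
  ultimately show ?thesis
    unfolding P_def by blast
qed

text \<open>Existence of a root hands its properties to the one picked by \<open>SOME\<close>. Here
  \<open>^^\<close> is iterated composition, so the square is the operator applied twice.\<close>

lemma op_abs_positive: "A \<in> bounded_ops R \<Longrightarrow> positive_op R (op_abs R A)"
  and op_abs_square: "A \<in> bounded_ops R \<Longrightarrow> f \<in> V \<Longrightarrow> (op_abs R A ^^ 2) f = adj R A (A f)"
proof -
  assume A: "A \<in> bounded_ops R"
  have *: "positive_op R (op_abs R A) \<and> (\<forall>f\<in>V. op_abs R A (op_abs R A f) = (adj R A \<circ> A) f)"
    unfolding op_abs_def op_sqrt_def using adj_comp_self_sqrt[OF A] by (rule someI_ex)
  then show "positive_op R (op_abs R A)"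
    by blast
  show "(op_abs R A ^^ 2) f = adj R A (A f)" if "f \<in> V"
    using * that by (simp add: numeral_2_eq_2)
qed

subsection \<open>Positive operators and Berezin quantities\<close>

text \<open>Polarisation: reality of the quadratic form at f + g settles the imaginary parts, at f +
  \<i> g the real parts.\<close>

lemma positive_op_hermitian:
  assumes A: "positive_op R A" and f: "f \<in> V" and g: "g \<in> V"
  shows "inn (A g) f = cnj (inn (A f) g)"
proof -
  have Aop: "A \<in> bounded_ops R" and real: "\<And>h. h \<in> V \<Longrightarrow> Im (inn (A h) h) = 0"
    using A by (auto simp: positive_op_def)
  have "Im (inn (A f) g + inn (A g) f) = 0"
    using real[of "f + g"] real[of f] real[of g] f g Aop by (simp add: bounded_ops_add[of A])
  moreover have "Re (inn (A f) g) = Re (inn (A g) f)"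
    using real[of "f + cscale \<i> g"] real[of f] real[of g] f g Aop
    by (simp add: bounded_ops_add[of A] bounded_ops_cscale[of A])
  ultimately show ?thesis
    by (simp add: complex_eq_iff)
qed

text \<open>Positivity at f - u g, with u a phase that makes the cross term equal to -2 |<A f, g>|.
  The arithmetic mean on the right suits suprema: each diagonal term is bounded separately.\<close>

lemma positive_op_cmod_le:
  assumes A: "positive_op R A" and f: "f \<in> V" and g: "g \<in> V"
  shows "cmod (inn (A f) g) \<le> (Re (inn (A f) f) + Re (inn (A g) g)) / 2"
proof -
  have Aop: "A \<in> bounded_ops R" and pos: "\<And>h. h \<in> V \<Longrightarrow> 0 \<le> Re (inn (A h) h)"
    using A by (auto simp: positive_op_def)
  define z where "z = inn (A f) g"
  \<comment> \<open>Since \<open>Arg 0 = 0\<close>, u = 1 for z = 0 and no case split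
    arises.\<close>
  define u where "u = cis (Arg z)"
  have z: "cnj u * z = of_real (cmod z)"
    using rcis_cmod_Arg[of z]
    by (metis cis_cnj cis_mult cis_zero mult.commute mult.left_commute mult.right_neutral rcis_def
        u_def add.right_inverse)
  have "0 \<le> Re (inn (A (f - cscale u g)) (f - cscale u g))"
    using f g by (intro pos) simp
  also have "inn (A (f - cscale u g)) (f - cscale u g)
      = inn (A f) f + (u * cnj u) * inn (A g) g - (cnj u * z + cnj (cnj u * z))"
    using f g Aop positive_op_hermitian[OF A f g]
    by (simp add: bounded_ops_diff[of A] bounded_ops_cscale[of A] z_def algebra_simps)
  also have "u * cnj u = 1"
    by (simp add: u_def cis_cnj cis_mult)
  also have "Re (inn (A f) f + 1 * inn (A g) g - (cnj u * z + cnj (cnj u * z)))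
      = Re (inn (A f) f) + Re (inn (A g) g) - 2 * cmod z"
    unfolding z by simp
  finally show ?thesis
    by (simp add: z_def)
qed

end

section \<open>Reproducing kernels, Berezin number and Berezin norm\<close>

locale rkhs_space =
  fixes R :: "'x fun_space"
  assumes rkhs: "rkhs R"

sublocale rkhs_space \<subseteq> hilbert_functions
  using rkhs by unfold_locales (auto simp: rkhs_def)

context rkhs_space
begin

lemma points_nonempty: "points R \<noteq> {}"
  and kernel_nonzero: "l \<in> points R \<Longrightarrow> kernel R l \<noteq> 0"
  and evaluation_continuous_at_point: "l \<in> points R \<Longrightarrow> evaluation_continuous R l"
  using rkhs by (auto simp: rkhs_def)

lemma evaluation_bounded:
  assumes l: "l \<in> points R"
  obtains C where "\<And>f. f \<in> V \<Longrightarrow> cmod (f l) \<le> C * nrm f"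
proof -
  obtain d where d: "d > 0" and small: "\<And>g. g \<in> V \<Longrightarrow> nrm g < d \<Longrightarrow> cmod (g l) < 1"
    using evaluation_continuous_at_point[OF l, unfolded evaluation_continuous_def, rule_format, of 0 1] by auto
  have "cmod (f l) \<le> 2 / d * nrm f" if f: "f \<in> V" for f
  proof (cases "f = 0")
    case False
    then have pos: "0 < nrm f"
      using f by (simp add: order_less_le vnorm_eq_0_iff eq_commute[of 0])
    \<comment> \<open>Rescales f to norm d/2, inside the ball on which continuity at 0 gives values
      below 1; hence the constant 2/d.\<close>
    define c where "c = d / (2 * nrm f)"
    have c: "c > 0"
      using d pos by (simp add: c_def)
    have "nrm (cscale (of_real c) f) < d"
      using d pos c f by (simp add: vnorm_cscale) (simp add: c_def)
    then have "c * cmod (f l) < 1"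
      using small[OF scale_mem[OF f], of "of_real c"] c by (simp add: cscale_def norm_mult)
    then show ?thesis
      using d pos by (simp add: c_def field_simps)
  qed simp
  then show ?thesis
    using that by blast
qed

lemma kernel_mem [simp]:
  assumes l: "l \<in> points R"
  shows "kernel R l \<in> V"
proof -
  obtain C where C: "\<And>f. f \<in> V \<Longrightarrow> cmod (f l) \<le> C * nrm f"
    using evaluation_bounded[OF l] by blast
  have "\<exists>!k. k \<in> V \<and> (\<forall>f\<in>V. f l = inn f k)"
    using C by (intro Riesz_representation[where C = C]) (auto simp: cscale_def)
  then show ?thesis
    unfolding kernel_def by (rule theI'[THEN conjunct1])
qed

lemma nkernel_mem [simp]: "l \<in> points R \<Longrightarrow> nkernel R l \<in> V"
  by (simp add: nkernel_def)

lemma vnorm_nkernel [simp]: "l \<in> points R \<Longrightarrow> nrm (nkernel R l) = 1"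
  using kernel_nonzero[of l] by (simp add: nkernel_def vnorm_cscale vnorm_eq_0_iff norm_divide)

text \<open>Guarantees that the real suprema in \<open>ber\<close> and \<open>ber_norm\<close> are
  taken over bounded sets and so really are upper bounds.\<close>

lemma bdd_above_ip_nkernel:
  assumes A: "A \<in> bounded_ops R"
  obtains C where
    "\<And>l m. l \<in> points R \<Longrightarrow> m \<in> points R \<Longrightarrow> cmod (inn (A (nkernel R l)) (nkernel R m)) \<le> C"
proof -
  obtain C where C: "\<And>f. f \<in> V \<Longrightarrow> nrm (A f) \<le> C * nrm f"
    using A bounded_ops_bound by metis
  have "cmod (inn (A (nkernel R l)) (nkernel R m)) \<le> C" if "l \<in> points R" "m \<in> points R" for l m
    using Cauchy_Schwarz[of "A (nkernel R l)" "nkernel R m"] C[of "nkernel R l"] A that by simp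
  then show ?thesis
    using that by blast
qed

lemma cmod_berezin_le_ber:
  assumes A: "A \<in> bounded_ops R" and l: "l \<in> points R"
  shows "cmod (berezin R A l) \<le> ber R A"
proof -
  obtain C where
    "\<And>l m. l \<in> points R \<Longrightarrow> m \<in> points R \<Longrightarrow> cmod (inn (A (nkernel R l)) (nkernel R m)) \<le> C"
    using bdd_above_ip_nkernel[OF A] by metis
  then have "bdd_above ((\<lambda>l. cmod (berezin R A l)) ` points R)"
    by (intro bdd_aboveI2[where M = C]) (simp add: berezin_def)
  then show ?thesis
    unfolding ber_def using l by (intro cSUP_upper)
qed

text \<open>An off-diagonal entry is at most the mean of two diagonal ones; conversely the pairs (l,
  l) occur in the larger supremum.\<close>

lemma ber_norm_positive:
  assumes A: "positive_op R A"
  shows "ber_norm R A = ber R A"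
proof (rule antisym)
  have Aop: "A \<in> bounded_ops R"
    using A by (simp add: positive_op_def)
  show "ber_norm R A \<le> ber R A"
    unfolding ber_norm_def
  proof (rule cSUP_least)
    fix p assume "p \<in> points R \<times> points R"
    then obtain l m where p: "p = (l, m)" and lm: "l \<in> points R" "m \<in> points R"
      by blast
    have "Re (berezin R A k) \<le> ber R A" if "k \<in> points R" for k
      using cmod_berezin_le_ber[OF Aop that] complex_Re_le_cmod order_trans by blast
    from this[OF lm(1)] this[OF lm(2)]
    have "cmod (inn (A (nkernel R l)) (nkernel R m)) \<le> ber R A"
      using positive_op_cmod_le[OF A, of "nkernel R l" "nkernel R m"] lm
      by (simp add: berezin_def)
    then show "(case p of (l, m) \<Rightarrow> cmod (inn (A (nkernel R l)) (nkernel R m))) \<le> ber R A"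
      by (simp add: p)
  qed (use points_nonempty in auto)
  show "ber R A \<le> ber_norm R A"
    unfolding ber_def
  proof (rule cSUP_least)
    fix l assume l: "l \<in> points R"
    obtain C where
      "\<And>l m. l \<in> points R \<Longrightarrow> m \<in> points R \<Longrightarrow> cmod (inn (A (nkernel R l)) (nkernel R m)) \<le> C"
      using bdd_above_ip_nkernel[OF Aop] by metis
    then have "bdd_above ((\<lambda>(l, m). cmod (inn (A (nkernel R l)) (nkernel R m)))
        ` (points R \<times> points R))"
      by (intro bdd_aboveI2[where M = C]) auto
    then show "cmod (berezin R A l) \<le> ber_norm R A"
      unfolding ber_norm_def berezin_def
      using l by (intro cSUP_upper2[where x = "(l, l)"]) auto
  qed (rule points_nonempty)
qed

text \<open>Carries the pointwise comparison to suprema. Each of the two bounds of the theorem is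
  one instance, with c = 2 \<alpha> sin \<theta>.\<close>

lemma ber_le_add:
  assumes "A \<in> bounded_ops R" "B \<in> bounded_ops R" "0 \<le> c"
    and "\<And>l. l \<in> points R \<Longrightarrow>
      cmod (berezin R D l) \<le> cmod (berezin R A l) + c * cmod (berezin R B l)"
  shows "ber R D \<le> ber R A + c * ber R B"
  unfolding ber_def[of R D]
proof (rule cSUP_least)
  fix l assume l: "l \<in> points R"
  have "c * cmod (berezin R B l) \<le> c * ber R B"
    using assms l by (intro mult_left_mono cmod_berezin_le_ber)
  then show "cmod (berezin R D l) \<le> ber R A + c * ber R B"
    using assms(4)[OF l] cmod_berezin_le_ber[OF assms(1) l] by linarith
qed (rule points_nonempty)

lemma berezin_adj_comp:
  assumes "A \<in> bounded_ops R" "B \<in> bounded_ops R" "l \<in> points R"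
  shows "berezin R (adj R A \<circ> B) l = inn (B (nkernel R l)) (A (nkernel R l))"
  using assms by (simp add: berezin_def ip_adj_left)

lemma adj_comp_self_positive:
  assumes A: "A \<in> bounded_ops R"
  shows "positive_op R (adj R A \<circ> A)"
  unfolding positive_op_def using A by (simp add: ip_adj_left)

lemma op_abs_square_positive:
  assumes A: "A \<in> bounded_ops R"
  shows "positive_op R (op_abs R A ^^ 2)"
proof -
  have "op_abs R A ^^ 2 = op_abs R A \<circ> op_abs R A"
    by (simp add: numeral_2_eq_2)
  then have "op_abs R A ^^ 2 \<in> bounded_ops R"
    using op_abs_positive[OF A] by (simp add: positive_op_def)
  then show ?thesis
    using adj_comp_self_positive[OF A] op_abs_square[OF A] by (simp add: positive_op_def)
qed

text \<open>The transform is real and nonnegative here, so the modulus disappears and the norm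
  expansions of sums and differences apply.\<close>

lemma cmod_berezin_op_abs_square:
  assumes A: "A \<in> bounded_ops R" and l: "l \<in> points R"
  shows "cmod (berezin R (op_abs R A ^^ 2) l) = (nrm (A (nkernel R l)))\<^sup>2"
  using A l by (simp add: berezin_def op_abs_square ip_adj_left ip_self norm_power)

end

text \<open>Im z = |z| sin (Arg z), |sin x| = sin |x| for |x| <= pi, and sin increases on
  [0, pi/2].\<close>

lemma abs_Im_le_of_sector:
  assumes "z \<in> sector \<theta>" "\<theta> < pi / 2"
  shows "\<bar>Im z\<bar> \<le> sin \<theta> * cmod z"
proof -
  have arg: "\<bar>Arg z\<bar> \<le> \<theta>"
    using assms by (simp add: sector_def)
  have "Im z = cmod z * sin (Arg z)"
    using rcis_cmod_Arg[of z] by (metis Im_rcis)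
  also have "\<bar>\<dots>\<bar> = cmod z * \<bar>sin (Arg z)\<bar>"
    by (simp add: abs_mult)
  also have "\<bar>sin (Arg z)\<bar> = sin \<bar>Arg z\<bar>"
  proof -
    have "0 \<le> sin \<bar>Arg z\<bar>"
      using arg assms pi_gt_zero by (intro sin_ge_zero) linarith+
    then show ?thesis
      by (cases "Arg z \<ge> 0") auto
  qed
  also have "cmod z * \<dots> \<le> cmod z * sin \<theta>"
    using arg assms by (intro mult_left_mono sin_monotone_2pi_le) (linarith | simp)+
  finally show ?thesis
    by (simp add: mult.commute)
qed

theorem theorem3p5:
  fixes R :: "'x fun_space" and S T :: "'x oper" and \<theta> \<alpha> :: real
  assumes "rkhs R"
    and "S \<in> bounded_ops R" and "T \<in> bounded_ops R"
    and "0 < \<theta>" and "\<theta> < pi / 2"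
    and "adj R T \<circ> S \<in> Pi_Ber R \<theta>"
    and "0 < \<alpha>"
  defines "\<beta>\<^sub>1 \<equiv> csc \<theta> / (2 * \<alpha>) *
      (ber_norm R (op_abs R (S + op_scale (\<i> * \<alpha>) T) ^^ 2)
       - ber_norm R ((adj R S \<circ> S) + op_scale (\<alpha>\<^sup>2) (adj R T \<circ> T)))"
    and "\<beta>\<^sub>2 \<equiv> csc \<theta> / (2 * \<alpha>) *
      (ber_norm R ((adj R S \<circ> S) + op_scale (\<alpha>\<^sup>2) (adj R T \<circ> T))
       - ber_norm R (op_abs R (S - op_scale (\<i> * \<alpha>) T) ^^ 2))"
  shows "ber R (adj R T \<circ> S) \<ge> max \<beta>\<^sub>1 \<beta>\<^sub>2"
proof -
  interpret rkhs_space R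
    using assms(1) by unfold_locales
  note S = assms(2) and T = assms(3) and \<alpha> = assms(7)
  define P where "P = (adj R S \<circ> S) + op_scale (\<alpha>\<^sup>2) (adj R T \<circ> T)"
  define U where "U = S + op_scale (\<i> * \<alpha>) T"
  define W where "W = S - op_scale (\<i> * \<alpha>) T"
  define D where "D = adj R T \<circ> S"
  have ops: "U \<in> bounded_ops R" "W \<in> bounded_ops R" "D \<in> bounded_ops R"
    using S T by (simp_all add: U_def W_def D_def)
  have ip_P: "inn (P f) f = of_real ((nrm (S f))\<^sup>2 + \<alpha>\<^sup>2 * (nrm (T f))\<^sup>2)" if "f \<in> V" for f
    using S T that by (simp add: P_def op_scale_def ip_adj_left ip_self)
  have Pop: "P \<in> bounded_ops R"
    using S T by (simp add: P_def)
  have P: "positive_op R P"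
    using Pop by (simp add: positive_op_def ip_P del: of_real_add of_real_mult of_real_power)
  have sin: "0 < sin \<theta>"
    using assms(4,5) pi_gt_zero by (intro sin_gt_zero) linarith+
  have cross: "\<bar>2 * \<alpha> * Im (berezin R D l)\<bar> \<le> 2 * \<alpha> * sin \<theta> * cmod (berezin R D l)"
    if "l \<in> points R" for l
  proof -
    have "berezin R D l \<in> sector \<theta>"
      using assms(6) that by (auto simp: Pi_Ber_def Ber_def D_def)
    then have "\<bar>Im (berezin R D l)\<bar> \<le> sin \<theta> * cmod (berezin R D l)"
      using assms(5) by (rule abs_Im_le_of_sector)
    then show ?thesis
      using \<alpha> by (simp add: mult.assoc abs_mult)
  qed
  have ber_P: "cmod (berezin R P l) = (nrm (S (nkernel R l)))\<^sup>2 + \<alpha>\<^sup>2 * (nrm (T (nkernel R l)))\<^sup>2"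
    if "l \<in> points R" for l
    unfolding berezin_def using ip_P[of "nkernel R l"] that
    by (simp del: of_real_add of_real_mult of_real_power)
  \<comment> \<open>The cross term is 2 Re <S k, \<i> \<alpha> T k> = 2 Re (-\<i> \<alpha> z) = 2
    \<alpha> Im z, the conjugation in the second slot turning \<i> into -\<i>.\<close>
  have ber_U: "cmod (berezin R (op_abs R U ^^ 2) l)
      = cmod (berezin R P l) + 2 * \<alpha> * Im (berezin R D l)" if "l \<in> points R" for l
    using that ops S T \<alpha> unfolding cmod_berezin_op_abs_square[OF ops(1) that] ber_P[OF that]
    by (simp add: D_def berezin_adj_comp U_def op_scale_def vnorm_add_sq vnorm_cscale norm_mult
        power_mult_distrib)
  have ber_W: "cmod (berezin R (op_abs R W ^^ 2) l)
      = cmod (berezin R P l) - 2 * \<alpha> * Im (berezin R D l)" if "l \<in> points R" for l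
    using that ops S T \<alpha> unfolding cmod_berezin_op_abs_square[OF ops(2) that] ber_P[OF that]
    by (simp add: D_def berezin_adj_comp W_def op_scale_def vnorm_diff_sq vnorm_cscale norm_mult
        power_mult_distrib)
  have abs_ops: "op_abs R W ^^ 2 \<in> bounded_ops R"
    using op_abs_square_positive[OF ops(2)] by (simp add: positive_op_def)
  have c: "0 \<le> 2 * \<alpha> * sin \<theta>"
    using \<alpha> sin by simp
  have "ber R (op_abs R U ^^ 2) \<le> ber R P + 2 * \<alpha> * sin \<theta> * ber R D"
  proof (rule ber_le_add[OF Pop ops(3) c])
    fix l assume l: "l \<in> points R"
    show "cmod (berezin R (op_abs R U ^^ 2) l)
        \<le> cmod (berezin R P l) + 2 * \<alpha> * sin \<theta> * cmod (berezin R D l)"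
      using cross[OF l] ber_U[OF l] by linarith
  qed
  \<comment> \<open>For the second bound P takes the larger side: its transform is that of |W|^2
    plus 2 \<alpha> Im z.\<close>
  moreover have "ber R P \<le> ber R (op_abs R W ^^ 2) + 2 * \<alpha> * sin \<theta> * ber R D"
  proof (rule ber_le_add[OF abs_ops ops(3) c])
    fix l assume l: "l \<in> points R"
    show "cmod (berezin R P l)
        \<le> cmod (berezin R (op_abs R W ^^ 2) l) + 2 * \<alpha> * sin \<theta> * cmod (berezin R D l)"
      using cross[OF l] ber_W[OF l] by linarith
  qed
  ultimately show ?thesis
    unfolding \<beta>\<^sub>1_def \<beta>\<^sub>2_def csc_def P_def[symmetric] U_def[symmetric] W_def[symmetric] D_def[symmetric]
    using \<alpha> sin
    by (simp add: ber_norm_positive[OF P] ber_norm_positive[OF op_abs_square_positive[OF ops(1)]]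
        ber_norm_positive[OF op_abs_square_positive[OF ops(2)]] field_simps)
qed

end
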